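(* Let $(\mathcal{M},g)$ be a smooth Riemannian manifold with Levi-Civita connection $D$, gradient $\nabla$, divergence $\mathrm{div}$ and Laplace-Beltrami operator $\Delta=\mathrm{div}\circ\nabla$. Let $\varepsilon$ be a random function on $\mathcal{M}$ that is almost surely $C^2$, and put $\widetilde X=\varepsilon X$ for every vector field $X$. Let $\widetilde\nabla$, $\widetilde{\mathrm{div}}$ and $\widetilde\Delta$ be the stochastic gradient, stochastic divergence and stochastic Laplace-Beltrami operator. Then, almost surely, for any $f\in C^\infty(\mathcal{M})$ and any smooth vector field $X$ on $\mathcal{M}$: 1. $\widetilde\nabla f=\varepsilon\nabla f$; 2. $\widetilde{\mathrm{div}}\,X=\mathrm{div}(\widetilde X)$; 3. $\widetilde\Delta f=\varepsilon^2\Delta f+2\varepsilon\,\nabla f(\varepsilon)$.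
   Context: Write $\langle X,Y\rangle=g(X,Y)$; for a vector field $V$ and a function $h$, $V(h)$ is the derivative of $h$ along $V$, so $\nabla f(\varepsilon)$ is the derivative of $\varepsilon$ along the vector field $\nabla f$. The stochastic gradient $\widetilde\nabla f$ is the vector field determined by $\langle X,\widetilde\nabla f\rangle=\widetilde X(f)$ for all vector fields $X$. The stochastic divergence of a vector field $X$ is the trace of the covariant derivative of $\widetilde X$, $\widetilde{\mathrm{div}}\,X:=\mathrm{trace}(Y\mapsto D_Y\widetilde X)$ (also applied to the $C^2$ field $\widetilde\nabla f$). The stochastic Laplace-Beltrami operator is $\widetilde\Delta f:=\widetilde{\mathrm{div}}(\widetilde\nabla f)$. *)

theory Defs
  imports "HOL-Probability.Probability"
begin

section \<open>Functions of class \<open>C\<^sup>k\<close> on open subsets of a normed space\<close>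

primrec Ck_on :: "nat \<Rightarrow> 'a::real_normed_vector set \<Rightarrow> ('a \<Rightarrow> 'b::real_normed_vector) \<Rightarrow> bool" where
  "Ck_on 0 S f \<longleftrightarrow> continuous_on S f"
| "Ck_on (Suc k) S f \<longleftrightarrow> (\<forall>x\<in>S. f differentiable (at x)) \<and>
     (\<forall>v. Ck_on k S (\<lambda>x. frechet_derivative f (at x) v))"

section \<open>Smooth manifolds\<close>

text \<open>
  A chart is a pair \<open>(U, \<phi>)\<close>; only the values of \<open>\<phi>\<close> on the domain \<open>U\<close> matter. The manifold is
  the whole type \<open>'m\<close>, and \<open>A\<close> is any smooth atlas on it (not necessarily maximal).
\<close>

type_synonym ('m, 'n) chart = "'m set \<times> ('m \<Rightarrow> real ^ 'n)"

definition chart_inv :: "('m, 'n::finite) chart \<Rightarrow> real ^ 'n \<Rightarrow> 'm" where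
  "chart_inv c = inv_into (fst c) (snd c)"

locale smooth_manifold =
  fixes A :: "('m::{t2_space, second_countable_topology}, 'n::finite) chart set"
  assumes open_domain: "c \<in> A \<Longrightarrow> open (fst c)"
    and open_range: "c \<in> A \<Longrightarrow> open (snd c ` fst c)"
    and chart_homeo: "c \<in> A \<Longrightarrow> homeomorphism (fst c) (snd c ` fst c) (snd c) (chart_inv c)"
    and charts_cover: "(\<Union>c\<in>A. fst c) = UNIV"
    and smooth_transition: "c \<in> A \<Longrightarrow> c' \<in> A \<Longrightarrow>
      Ck_on k (snd c ` (fst c \<inter> fst c')) (\<lambda>x. snd c' (chart_inv c x))"

definition Ck_fun :: "('m, 'n::finite) chart set \<Rightarrow> nat \<Rightarrow> ('m \<Rightarrow> real) \<Rightarrow> bool" where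
  "Ck_fun A k h \<longleftrightarrow> (\<forall>c\<in>A. Ck_on k (snd c ` fst c) (\<lambda>x. h (chart_inv c x)))"

definition smooth_fun :: "('m, 'n::finite) chart set \<Rightarrow> ('m \<Rightarrow> real) \<Rightarrow> bool" where
  "smooth_fun A h \<longleftrightarrow> (\<forall>k. Ck_fun A k h)"

section \<open>Tangent vectors and vector fields\<close>

text \<open>
  A tangent vector at \<open>p\<close> is a directional derivative operator \<open>h \<mapsto> v h\<close> on the real functions that
  are differentiable at \<open>p\<close>, extended by \<open>0\<close> to all other functions so that equality of tangent
  vectors is equality of operators. (Abstract derivations of \<open>C\<^sup>1\<close> or \<open>C\<^sup>2\<close> functions would not do,
  since there are too many of them; on the other hand, tangent vectors must act on \<open>C\<^sup>2\<close> functions.)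
  For a vector field \<open>X\<close>, the function \<open>X(h)\<close> is \<open>\<lambda>p. X p h\<close>.
\<close>

type_synonym 'm tvec = "('m \<Rightarrow> real) \<Rightarrow> real"
type_synonym 'm vfield = "'m \<Rightarrow> 'm tvec"

definition diff_at :: "('m, 'n::finite) chart set \<Rightarrow> 'm \<Rightarrow> ('m \<Rightarrow> real) \<Rightarrow> bool" where
  "diff_at A p h \<longleftrightarrow>
     (\<forall>c\<in>A. p \<in> fst c \<longrightarrow> (\<lambda>x. h (chart_inv c x)) differentiable (at (snd c p)))"

definition chart_tvec :: "('m, 'n::finite) chart set \<Rightarrow> ('m, 'n) chart \<Rightarrow> 'm \<Rightarrow> real ^ 'n \<Rightarrow> 'm tvec" where
  "chart_tvec A c p w = (\<lambda>h. if diff_at A p h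
     then frechet_derivative (\<lambda>x. h (chart_inv c x)) (at (snd c p)) w else 0)"

definition tangent_space :: "('m, 'n::finite) chart set \<Rightarrow> 'm \<Rightarrow> 'm tvec set" where
  "tangent_space A p = {v. \<exists>c\<in>A. \<exists>w. p \<in> fst c \<and> v = chart_tvec A c p w}"

abbreviation coord_vec :: "('m, 'n::finite) chart set \<Rightarrow> ('m, 'n) chart \<Rightarrow> 'm \<Rightarrow> 'n \<Rightarrow> 'm tvec" where
  "coord_vec A c p j \<equiv> chart_tvec A c p (axis j 1)"

text \<open>The \<open>i\<close>-th component of \<open>v\<close> with respect to the coordinate basis is \<open>v(\<phi>\<^sub>i)\<close>.\<close>

definition Ck_field :: "('m, 'n::finite) chart set \<Rightarrow> nat \<Rightarrow> 'm vfield \<Rightarrow> bool" where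
  "Ck_field A k X \<longleftrightarrow> (\<forall>p. X p \<in> tangent_space A p) \<and>
     (\<forall>c\<in>A. \<forall>i. Ck_on k (snd c ` fst c) (\<lambda>x. X (chart_inv c x) (\<lambda>q. snd c q $ i)))"

definition smooth_field :: "('m, 'n::finite) chart set \<Rightarrow> 'm vfield \<Rightarrow> bool" where
  "smooth_field A X \<longleftrightarrow> (\<forall>k. Ck_field A k X)"

definition scale_field :: "('m \<Rightarrow> real) \<Rightarrow> 'm vfield \<Rightarrow> 'm vfield" where
  "scale_field h X = (\<lambda>p f. h p * X p f)"

text \<open>
  Trace of a linear endomorphism \<open>L\<close> of the tangent space at \<open>p\<close>, as the trace of its matrix in the
  coordinate basis of some chart around \<open>p\<close>; the value does not depend on the chart.
\<close>

definition tangent_trace :: "('m, 'n::finite) chart set \<Rightarrow> 'm \<Rightarrow> ('m tvec \<Rightarrow> 'm tvec) \<Rightarrow> real" where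
  "tangent_trace A p L = (let c = (SOME c. c \<in> A \<and> p \<in> fst c)
     in trace (\<chi> i j. L (coord_vec A c p j) (\<lambda>q. snd c q $ i)))"

section \<open>Riemannian metrics and the Levi-Civita connection\<close>

locale riemannian_manifold = smooth_manifold A
  for A :: "('m::{t2_space, second_countable_topology}, 'n::finite) chart set" +
  fixes g :: "'m \<Rightarrow> 'm tvec \<Rightarrow> 'm tvec \<Rightarrow> real"
  assumes metric_sym: "v \<in> tangent_space A p \<Longrightarrow> w \<in> tangent_space A p \<Longrightarrow> g p v w = g p w v"
    and metric_linear: "u \<in> tangent_space A p \<Longrightarrow> v \<in> tangent_space A p \<Longrightarrow> w \<in> tangent_space A p \<Longrightarrow>
      g p (\<lambda>h. a * u h + b * v h) w = a * g p u w + b * g p v w"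
    and metric_pos: "v \<in> tangent_space A p \<Longrightarrow> v \<noteq> (\<lambda>h. 0) \<Longrightarrow> g p v v > 0"
    and metric_smooth: "c \<in> A \<Longrightarrow> Ck_on k (snd c ` fst c)
      (\<lambda>x. g (chart_inv c x) (coord_vec A c (chart_inv c x) i) (coord_vec A c (chart_inv c x) j))"

text \<open>
  \<open>D p v Y\<close> is the covariant derivative at \<open>p\<close> of the \<open>C\<^sup>1\<close> field \<open>Y\<close> in the direction \<open>v\<close>, so that
  \<open>D\<^sub>X Y\<close> is \<open>\<lambda>p. D p (X p) Y\<close>. The axioms are imposed on \<open>C\<^sup>1\<close> fields, since the connection is
  applied to \<open>C\<^sup>2\<close> fields. In the torsion axiom, the Lie bracket acts by \<open>[X,Y](f) = X(Y(f)) - Y(X(f))\<close>.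
\<close>

locale levi_civita_connection = riemannian_manifold A g
  for A :: "('m::{t2_space, second_countable_topology}, 'n::finite) chart set"
    and g :: "'m \<Rightarrow> 'm tvec \<Rightarrow> 'm tvec \<Rightarrow> real" +
  fixes D :: "'m \<Rightarrow> 'm tvec \<Rightarrow> 'm vfield \<Rightarrow> 'm tvec"
  assumes conn_tangent: "v \<in> tangent_space A p \<Longrightarrow> Ck_field A 1 Y \<Longrightarrow> D p v Y \<in> tangent_space A p"
    and conn_smooth: "smooth_field A X \<Longrightarrow> smooth_field A Y \<Longrightarrow> smooth_field A (\<lambda>p. D p (X p) Y)"
    and conn_linear: "v \<in> tangent_space A p \<Longrightarrow> w \<in> tangent_space A p \<Longrightarrow> Ck_field A 1 Y \<Longrightarrow>
      D p (\<lambda>h. a * v h + b * w h) Y = (\<lambda>h. a * D p v Y h + b * D p w Y h)"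
    and conn_add: "v \<in> tangent_space A p \<Longrightarrow> Ck_field A 1 Y \<Longrightarrow> Ck_field A 1 Z \<Longrightarrow>
      D p v (\<lambda>q h. Y q h + Z q h) = (\<lambda>h. D p v Y h + D p v Z h)"
    and conn_Leibniz: "v \<in> tangent_space A p \<Longrightarrow> Ck_fun A 1 \<eta> \<Longrightarrow> Ck_field A 1 Y \<Longrightarrow>
      D p v (scale_field \<eta> Y) = (\<lambda>h. v \<eta> * Y p h + \<eta> p * D p v Y h)"
    and conn_metric: "v \<in> tangent_space A p \<Longrightarrow> Ck_field A 1 Y \<Longrightarrow> Ck_field A 1 Z \<Longrightarrow>
      v (\<lambda>q. g q (Y q) (Z q)) = g p (D p v Y) (Z p) + g p (Y p) (D p v Z)"
    and conn_torsion_free: "Ck_field A 1 X \<Longrightarrow> Ck_field A 1 Y \<Longrightarrow> smooth_fun A f \<Longrightarrow>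
      D p (X p) Y f - D p (Y p) X f = X p (\<lambda>q. Y q f) - Y p (\<lambda>q. X q f)"

section \<open>Gradient, divergence, Laplace-Beltrami operator and their stochastic versions\<close>

definition grad :: "('m, 'n::finite) chart set \<Rightarrow> ('m \<Rightarrow> 'm tvec \<Rightarrow> 'm tvec \<Rightarrow> real) \<Rightarrow>
    ('m \<Rightarrow> real) \<Rightarrow> 'm vfield" where
  "grad A g f = (THE G. smooth_field A G \<and>
     (\<forall>X. smooth_field A X \<longrightarrow> (\<forall>p. g p (X p) (G p) = X p f)))"

definition diverg :: "('m, 'n::finite) chart set \<Rightarrow> ('m \<Rightarrow> 'm tvec \<Rightarrow> 'm vfield \<Rightarrow> 'm tvec) \<Rightarrow>
    'm vfield \<Rightarrow> 'm \<Rightarrow> real" where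
  "diverg A D X = (\<lambda>p. tangent_trace A p (\<lambda>v. D p v X))"

definition laplace :: "('m, 'n::finite) chart set \<Rightarrow> ('m \<Rightarrow> 'm tvec \<Rightarrow> 'm tvec \<Rightarrow> real) \<Rightarrow>
    ('m \<Rightarrow> 'm tvec \<Rightarrow> 'm vfield \<Rightarrow> 'm tvec) \<Rightarrow> ('m \<Rightarrow> real) \<Rightarrow> 'm \<Rightarrow> real" where
  "laplace A g D f = diverg A D (grad A g f)"

text \<open>
  The stochastic operators are defined for one realisation \<open>e\<close> of the random function, with
  \<open>scale_field e X\<close> in the role of the field \<open>e X\<close>.
\<close>

definition stoch_grad :: "('m, 'n::finite) chart set \<Rightarrow> ('m \<Rightarrow> 'm tvec \<Rightarrow> 'm tvec \<Rightarrow> real) \<Rightarrow>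
    ('m \<Rightarrow> real) \<Rightarrow> ('m \<Rightarrow> real) \<Rightarrow> 'm vfield" where
  "stoch_grad A g e f = (THE G. Ck_field A 2 G \<and>
     (\<forall>X. smooth_field A X \<longrightarrow> (\<forall>p. g p (X p) (G p) = scale_field e X p f)))"

definition stoch_diverg :: "('m, 'n::finite) chart set \<Rightarrow> ('m \<Rightarrow> 'm tvec \<Rightarrow> 'm vfield \<Rightarrow> 'm tvec) \<Rightarrow>
    ('m \<Rightarrow> real) \<Rightarrow> 'm vfield \<Rightarrow> 'm \<Rightarrow> real" where
  "stoch_diverg A D e X = (\<lambda>p. tangent_trace A p (\<lambda>v. D p v (scale_field e X)))"

definition stoch_laplace :: "('m, 'n::finite) chart set \<Rightarrow> ('m \<Rightarrow> 'm tvec \<Rightarrow> 'm tvec \<Rightarrow> real) \<Rightarrow>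
    ('m \<Rightarrow> 'm tvec \<Rightarrow> 'm vfield \<Rightarrow> 'm tvec) \<Rightarrow> ('m \<Rightarrow> real) \<Rightarrow> ('m \<Rightarrow> real) \<Rightarrow> 'm \<Rightarrow> real" where
  "stoch_laplace A g D e f = stoch_diverg A D e (stoch_grad A g e f)"

end

theory Submission
  imports Defs
begin

text \<open>
  All three identities hold for each single realisation \<open>e\<close> of the random function that is \<open>C\<^sup>2\<close>, so
  the probabilistic part is only to discard the null set of other realisations.

  The field \<open>e \<nabla>f\<close> satisfies \<open>\<langle>X, e \<nabla>f\<rangle> = e X(f)\<close> by linearity of the metric, and the identity for
  the divergence is the definition. For the Laplacian, \<open>e \<cdot> (e \<nabla>f) = e\<^sup>2 \<nabla>f\<close>, and tracing the Leibniz
  rule gives \<open>div (\<eta> X) = \<eta> div X + X(\<eta>)\<close> (\<open>diverg_scale_field\<close>); with \<open>\<eta> = e\<^sup>2\<close> and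
  \<open>X = \<nabla>f\<close> the last term is \<open>\<nabla>f(e\<^sup>2) = 2 e \<nabla>f(e)\<close>.

  The work lies in showing that the two gradients, which are given by definite descriptions, exist and
  are unique. Uniqueness needs enough smooth fields to test against: every tangent vector is the value
  of a global smooth field (\<open>ex_smooth_field\<close>), which is built in one chart with a bump function and
  extended by zero. The extension is smooth because a compact subset of a Hausdorff space is closed.
  Nondegeneracy of the metric then determines a field from its inner products with smooth fields,
  whatever the regularity of that field (\<open>field_eqI\<close>). Existence is linear algebra
  in a chart: the components of \<open>\<nabla>f\<close> solve the linear system with the Gram matrix of the coordinate basis
  and the partial derivatives of \<open>f\<close> as right-hand side, and Cramer's rule expresses them by
  determinants, whose smoothness follows from the calculus of \<open>C\<^sup>k\<close> functions.
\<close>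

section \<open>Calculus of \<open>C\<^sup>k\<close> functions\<close>

lemma Ck_on_cong:
  assumes "Ck_on k S f" "open S" "\<And>x. x \<in> S \<Longrightarrow> f x = g x"
  shows "Ck_on k S g"
  using assms
proof (induction k arbitrary: f g)
  case 0
  then show ?case by (simp cong: continuous_on_cong)
next
  case (Suc k)
  have g: "(g has_derivative frechet_derivative f (at x)) (at x)" if "x \<in> S" for x
  proof (rule has_derivative_transform_within_open[OF _ \<open>open S\<close> that])
    show "(f has_derivative frechet_derivative f (at x)) (at x)"
      using Suc.prems(1) that frechet_derivative_works by auto
  qed (use Suc.prems in auto)
  have "Ck_on k S (\<lambda>x. frechet_derivative g (at x) v)" for v
    by (rule Suc.IH[of "\<lambda>x. frechet_derivative f (at x) v"])
      (use Suc.prems g frechet_derivative_at in fastforce)+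
  then show ?case
    using g by (auto simp: differentiable_def)
qed

text \<open>
  The induction step of the product, chain and quotient rules: it is enough to know the derivative by some
  formula on \<open>S\<close>, since openness of \<open>S\<close> lets \<open>Ck_on\<close> be transported along equality on \<open>S\<close>.
\<close>

lemma Ck_on_Suc_has_derivative:
  assumes "open S"
    and "\<And>x. x \<in> S \<Longrightarrow> (f has_derivative f' x) (at x)"
    and "\<And>v. Ck_on k S (\<lambda>x. f' x v)"
  shows "Ck_on (Suc k) S f"
proof -
  have "Ck_on k S (\<lambda>x. frechet_derivative f (at x) v)" for v
    by (rule Ck_on_cong[OF assms(3)[of v] \<open>open S\<close>]) (use assms(2) frechet_derivative_at in metis)
  then show ?thesis
    using assms(2) by (auto simp: differentiable_def)
qed

lemma Ck_on_Suc_imp_has_derivative: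
  assumes "Ck_on (Suc k) S f" "x \<in> S"
  shows "(f has_derivative frechet_derivative f (at x)) (at x)"
  using assms frechet_derivative_works by auto

lemma Ck_on_SucD: "Ck_on (Suc k) S f \<Longrightarrow> Ck_on k S f"
proof (induction k arbitrary: f)
  case 0
  then have "f differentiable_on S"
    by (simp add: differentiable_on_def differentiable_at_withinI)
  then show ?case
    by (simp add: differentiable_imp_continuous_on)
qed auto

lemma Ck_on_mono: "Ck_on k S f \<Longrightarrow> j \<le> k \<Longrightarrow> Ck_on j S f"
  by (induction k) (metis le_zero_eq, metis Ck_on_SucD le_Suc_eq)

lemma Ck_on_open_Un: "open S \<Longrightarrow> open T \<Longrightarrow> Ck_on k S f \<Longrightarrow> Ck_on k T f \<Longrightarrow> Ck_on k (S \<union> T) f"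
  by (induction k arbitrary: f) (auto intro: continuous_on_open_Un)

lemma Ck_on_const [simp]: "Ck_on k S (\<lambda>x. c)"
  by (induction k arbitrary: c) auto

lemma Ck_on_add:
  assumes "open S" "Ck_on k S f" "Ck_on k S g"
  shows "Ck_on k S (\<lambda>x. f x + g x)"
  using assms
proof (induction k arbitrary: f g)
  case (Suc k)
  show ?case
    by (rule Ck_on_Suc_has_derivative[OF \<open>open S\<close>
          has_derivative_add[OF Suc.prems(2,3)[THEN Ck_on_Suc_imp_has_derivative]]])
      (use Suc in auto)
qed (auto intro: continuous_intros)

lemma Ck_on_sum:
  assumes "open S" "\<And>i. i \<in> I \<Longrightarrow> Ck_on k S (f i)"
  shows "Ck_on k S (\<lambda>x. \<Sum>i\<in>I. f i x)"
  using assms(2)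
  by (induction I rule: infinite_finite_induct) (auto intro: Ck_on_add[OF \<open>open S\<close>])

lemma Ck_on_linear_compose:
  assumes "bounded_linear L" "open S" "Ck_on k S f"
  shows "Ck_on k S (\<lambda>x. L (f x))"
  using assms(3)
proof (induction k arbitrary: f)
  case 0
  then show ?case
    using bounded_linear.continuous_on[OF assms(1)] by auto
next
  case (Suc k)
  show ?case
    by (rule Ck_on_Suc_has_derivative[OF \<open>open S\<close> bounded_linear.has_derivative[OF assms(1)
            Ck_on_Suc_imp_has_derivative[OF Suc.prems]]])
      (use Suc in auto)
qed

lemma Ck_on_id [simp]:
  assumes "open S"
  shows "Ck_on k S (\<lambda>x. x)"
proof (cases k)
  case (Suc j)
  show ?thesis
    unfolding Suc by (rule Ck_on_Suc_has_derivative[OF assms has_derivative_ident]) auto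
qed (auto)

lemma Ck_on_mult:
  fixes f g :: "'a::real_normed_vector \<Rightarrow> real"
  assumes "open S" "Ck_on k S f" "Ck_on k S g"
  shows "Ck_on k S (\<lambda>x. f x * g x)"
  using assms
proof (induction k arbitrary: f g)
  case (Suc k)
  show ?case
    by (rule Ck_on_Suc_has_derivative[OF \<open>open S\<close>
          has_derivative_mult[OF Suc.prems(2,3)[THEN Ck_on_Suc_imp_has_derivative]]])
      (use Suc Suc.prems(2,3)[THEN Ck_on_SucD] in \<open>auto intro!: Ck_on_add\<close>)
qed (auto intro: continuous_intros)

lemma Ck_on_prod:
  fixes f :: "'i \<Rightarrow> 'a::real_normed_vector \<Rightarrow> real"
  assumes "open S" "\<And>i. i \<in> I \<Longrightarrow> Ck_on k S (f i)"
  shows "Ck_on k S (\<lambda>x. \<Prod>i\<in>I. f i x)"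
  using assms(2)
  by (induction I rule: infinite_finite_induct) (auto intro: Ck_on_mult[OF \<open>open S\<close>])

text \<open>
  The chain rule \<open>D(h \<circ> f) v = Dh(f x) (Df(x) v)\<close> is not covered by the induction hypothesis as it
  stands, because the direction in which \<open>h\<close> is differentiated varies with \<open>x\<close>. Expanding \<open>Df(x) v\<close> in
  the standard basis leaves only derivatives of \<open>h\<close> in fixed directions.
\<close>

lemma Ck_on_compose:
  fixes f :: "'a::real_normed_vector \<Rightarrow> 'b::euclidean_space" and h :: "'b \<Rightarrow> real"
  assumes "open S" "Ck_on k S f" "Ck_on k T h" "f ` S \<subseteq> T"
  shows "Ck_on k S (\<lambda>x. h (f x))"
  using assms
proof (induction k arbitrary: h)
  case 0
  then show ?case
    by (auto intro: continuous_on_compose2)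
next
  case (Suc k)
  note f = Ck_on_Suc_imp_has_derivative[OF Suc.prems(2)]
  have h: "(h has_derivative frechet_derivative h (at (f x))) (at (f x))" if "x \<in> S" for x
    using Ck_on_Suc_imp_has_derivative[OF Suc.prems(3)] that Suc.prems(4) by auto
  have chain: "((\<lambda>x. h (f x)) has_derivative (\<lambda>v. \<Sum>b\<in>Basis.
      (frechet_derivative f (at x) v \<bullet> b) * frechet_derivative h (at (f x)) b)) (at x)"
    if "x \<in> S" for x
  proof -
    have "linear (frechet_derivative h (at (f x)))"
      using h[OF that] has_derivative_linear by blast
    then have "frechet_derivative h (at (f x)) w =
        (\<Sum>b\<in>Basis. (w \<bullet> b) * frechet_derivative h (at (f x)) b)" for w
      by (subst euclidean_representation[of w, symmetric])
        (simp add: linear_sum linear_cmul)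
    then show ?thesis
      by (intro has_derivative_eq_rhs[OF has_derivative_compose[OF f[OF that] h[OF that]]] ext)
  qed
  show ?case
  proof (rule Ck_on_Suc_has_derivative[OF \<open>open S\<close> chain])
    fix v
    have "Ck_on k S (\<lambda>x. frechet_derivative f (at x) v \<bullet> b)" for b
      using Suc.prems(2)
      by (intro Ck_on_linear_compose[OF bounded_linear_inner_left \<open>open S\<close>]) auto
    moreover have "Ck_on k S (\<lambda>x. frechet_derivative h (at (f x)) b)" for b
      using Suc.prems Ck_on_SucD[OF Suc.prems(2)] by (intro Suc.IH) auto
    ultimately show "Ck_on k S (\<lambda>x. \<Sum>b\<in>Basis.
        (frechet_derivative f (at x) v \<bullet> b) * frechet_derivative h (at (f x)) b)"
      by (intro Ck_on_sum Ck_on_mult \<open>open S\<close>)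
  qed auto
qed

lemma Ck_on_inverse: "Ck_on k (-{0::real}) inverse"
proof (induction k)
  case (Suc k)
  have "Ck_on k (-{0}) (\<lambda>x. - (inverse x * v * inverse x))" for v :: real
    using Ck_on_linear_compose[OF bounded_linear_minus[OF bounded_linear_ident] _
        Ck_on_mult[OF _ Ck_on_mult[OF _ Suc Ck_on_const[of _ _ v]] Suc]]
    by auto
  then show ?case
    by (intro Ck_on_Suc_has_derivative[OF _ has_derivative_inverse']) auto
qed (auto intro: continuous_intros)

lemma Ck_on_divide:
  fixes f g :: "'a::real_normed_vector \<Rightarrow> real"
  assumes "open S" "Ck_on k S f" "Ck_on k S g" "\<And>x. x \<in> S \<Longrightarrow> g x \<noteq> 0"
  shows "Ck_on k S (\<lambda>x. f x / g x)"
  unfolding divide_inverse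
  using assms by (intro Ck_on_mult Ck_on_compose[OF _ _ Ck_on_inverse]) auto

lemma Ck_on_det:
  fixes M :: "'a::real_normed_vector \<Rightarrow> real ^ 'n ^ 'n"
  assumes "open S" "\<And>i j. Ck_on k S (\<lambda>x. M x $ i $ j)"
  shows "Ck_on k S (\<lambda>x. det (M x))"
  unfolding det_def
  using assms by (intro Ck_on_sum Ck_on_mult Ck_on_prod) auto

section \<open>Bump functions\<close>

text \<open>
  The factors \<open>1/t^n\<close> make the family closed under differentiation up to linear combinations, so that
  smoothness of all its members is proved in a single induction.
\<close>

definition flat_exp :: "nat \<Rightarrow> real \<Rightarrow> real" where
  "flat_exp n t = (if t > 0 then inverse t ^ n * exp (- inverse t) else 0)"

lemma flat_exp_has_derivative_at_0: "(flat_exp n has_real_derivative 0) (at 0)"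
proof -
  (* The difference quotient of the n-th function at 0 is the (n+1)-st function. *)
  have "((\<lambda>t. inverse t ^ Suc n / exp (inverse t)) \<longlongrightarrow> (0::real)) (at_right 0)"
    using filterlim_compose[OF tendsto_power_div_exp_0 filterlim_inverse_at_top_right] .
  then have right: "((\<lambda>t. flat_exp n t / t) \<longlongrightarrow> 0) (at_right 0)"
    by (rule Lim_transform_eventually)
      (auto simp: eventually_at_filter flat_exp_def exp_minus divide_inverse)
  have left: "((\<lambda>t. flat_exp n t / t) \<longlongrightarrow> 0) (at_left 0)"
    by (rule Lim_transform_eventually[OF tendsto_const])
      (auto simp: eventually_at_filter flat_exp_def)
  from left right have "((\<lambda>t. flat_exp n t / t) \<longlongrightarrow> 0) (at 0)"
    by (simp add: filterlim_split_at)
  then show ?thesis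
    by (simp add: DERIV_def flat_exp_def)
qed

lemma flat_exp_has_derivative:
  "(flat_exp n has_real_derivative (flat_exp (n + 2) t - real n * flat_exp (n + 1) t)) (at t)"
proof -
  consider "t > 0" | "t < 0" | "t = 0"
    by linarith
  then show ?thesis
  proof cases
    case 1
    have "((\<lambda>t. inverse t ^ n * exp (- inverse t)) has_real_derivative
        (flat_exp (n + 2) t - real n * flat_exp (n + 1) t)) (at t)"
      using 1
      apply (auto intro!: derivative_eq_intros simp: flat_exp_def)
      apply (cases n; simp add: field_simps power2_eq_square)
      done
    then show ?thesis
      by (rule has_field_derivative_transform_within_open[of _ _ _ "{0<..}"])
        (use 1 in \<open>auto simp: flat_exp_def\<close>)
  next
    case 2
    have "((\<lambda>t. 0) has_real_derivative (flat_exp (n + 2) t - real n * flat_exp (n + 1) t)) (at t)"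
      using 2 by (auto simp: flat_exp_def)
    then show ?thesis
      by (rule has_field_derivative_transform_within_open[of _ _ _ "{..<0}"])
        (use 2 in \<open>auto simp: flat_exp_def\<close>)
  next
    case 3
    then show ?thesis
      using flat_exp_has_derivative_at_0 by (simp add: flat_exp_def)
  qed
qed

lemma Ck_on_flat_exp: "Ck_on k UNIV (flat_exp n)"
proof (induction k arbitrary: n)
  case 0
  have "isCont (flat_exp n) t" for t
    using flat_exp_has_derivative DERIV_isCont by blast
  then show ?case
    by (simp add: continuous_at_imp_continuous_on)
next
  case (Suc k)
  show ?case
  proof (rule Ck_on_Suc_has_derivative)
    show "(flat_exp n has_derivative (\<lambda>v. (flat_exp (n + 2) t + (- real n) * flat_exp (n + 1) t) * v)) (at t)"
      for t
      using flat_exp_has_derivative[of n t] by (simp add: has_field_derivative_def)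
    show "Ck_on k UNIV (\<lambda>t. (flat_exp (n + 2) t + (- real n) * flat_exp (n + 1) t) * v)" for v
      by (intro Ck_on_mult Ck_on_add Ck_on_const Suc) auto
  qed auto
qed

text \<open>The function is a multiple of \<open>exp (- 1 / (r\<^sup>2 - \<parallel>x - a\<parallel>\<^sup>2))\<close> on the ball.\<close>

lemma ex_Ck_bump:
  fixes a :: "'a::euclidean_space"
  assumes "r > 0"
  obtains \<psi> :: "'a \<Rightarrow> real"
  where "\<And>k. Ck_on k UNIV \<psi>" "\<psi> a = 1" "\<And>x. x \<notin> cball a r \<Longrightarrow> \<psi> x = 0"
proof
  (* Written with sums and products only, so that the closure properties of Ck_on apply. *)
  let ?b = "\<lambda>x. r\<^sup>2 + (-1) * (\<Sum>i\<in>Basis. (x \<bullet> i + - (a \<bullet> i)) * (x \<bullet> i + - (a \<bullet> i)))"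
  let ?\<psi> = "\<lambda>x. exp (inverse (r\<^sup>2)) * flat_exp 0 (?b x)"
  have b: "?b x = r\<^sup>2 - (dist a x)\<^sup>2" for x
    unfolding dist_norm power2_norm_eq_inner
    by (subst euclidean_inner) (simp add: inner_diff_left algebra_simps)
  show "Ck_on k UNIV ?\<psi>" for k
    by (intro Ck_on_mult Ck_on_compose[OF _ _ Ck_on_flat_exp] Ck_on_add Ck_on_sum Ck_on_const
        Ck_on_linear_compose[OF bounded_linear_inner_left] Ck_on_id) auto
  show "?\<psi> a = 1"
    using assms unfolding b by (simp add: flat_exp_def exp_minus)
  show "?\<psi> x = 0" if "x \<notin> cball a r" for x
    using that assms unfolding b by (simp add: flat_exp_def power_mono not_less)
qed


section \<open>Charts and tangent vectors\<close>

lemma linear_vec_expansion: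
  fixes L :: "real ^ 'k \<Rightarrow> real"
  assumes "linear L"
  shows "L w = (\<Sum>i\<in>UNIV. w $ i * L (axis i 1))"
proof -
  have "L w = L (\<Sum>i\<in>UNIV. w $ i *\<^sub>R axis i 1)"
    using basis_expansion[of w] by (simp add: scalar_mult_eq_scaleR)
  then show ?thesis
    using assms by (simp add: linear_sum linear_cmul)
qed

context smooth_manifold
begin

lemma chart_inv_left [simp]: "c \<in> A \<Longrightarrow> p \<in> fst c \<Longrightarrow> chart_inv c (snd c p) = p"
  using chart_homeo[of c] by (auto simp: homeomorphism_def)

lemma chart_inv_right: "c \<in> A \<Longrightarrow> x \<in> snd c ` fst c \<Longrightarrow> snd c (chart_inv c x) = x"
  using chart_homeo[of c] by (auto simp: homeomorphism_def)

lemma chart_inv_in: "c \<in> A \<Longrightarrow> x \<in> snd c ` fst c \<Longrightarrow> chart_inv c x \<in> fst c"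
  by auto

lemma ex_chart_around:
  obtains c where "c \<in> A" "p \<in> fst c"
  using charts_cover by blast

lemma open_chart_image:
  assumes "c \<in> A" "open U" "U \<subseteq> fst c"
  shows "open (snd c ` U)"
proof -
  have "openin (top_of_set (snd c ` fst c)) (snd c ` U)"
    using homeomorphism_imp_open_map[OF chart_homeo[OF assms(1)], of U] assms(2,3)
    by (auto simp: openin_open)
  then show ?thesis
    using open_range[OF assms(1)] openin_open_trans by blast
qed

lemma open_overlap: "c \<in> A \<Longrightarrow> c' \<in> A \<Longrightarrow> open (snd c ` (fst c \<inter> fst c'))"
  by (intro open_chart_image open_Int open_domain) auto

lemma transition_has_derivative:
  assumes "c \<in> A" "c' \<in> A" "p \<in> fst c" "p \<in> fst c'"
  shows "((\<lambda>x. snd c' (chart_inv c x)) has_derivative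
    frechet_derivative (\<lambda>x. snd c' (chart_inv c x)) (at (snd c p))) (at (snd c p))"
  by (rule Ck_on_Suc_imp_has_derivative[OF smooth_transition[OF assms(1,2), of "Suc 0"]])
    (use assms(3,4) in auto)

lemma has_derivative_change_chart:
  assumes "c \<in> A" "c' \<in> A" "p \<in> fst c" "p \<in> fst c'"
    and "((\<lambda>x. h (chart_inv c' x)) has_derivative h') (at (snd c' p))"
  shows "((\<lambda>x. h (chart_inv c x)) has_derivative
    (\<lambda>w. h' (frechet_derivative (\<lambda>x. snd c' (chart_inv c x)) (at (snd c p)) w))) (at (snd c p))"
proof (rule has_derivative_transform_within_open)
  have "((\<lambda>x. h (chart_inv c' x)) has_derivative h') (at (snd c' (chart_inv c (snd c p))))"
    using assms by simp
  from has_derivative_compose[OF transition_has_derivative[OF assms(1-4)] this]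
  show "((\<lambda>x. h (chart_inv c' (snd c' (chart_inv c x)))) has_derivative
    (\<lambda>w. h' (frechet_derivative (\<lambda>x. snd c' (chart_inv c x)) (at (snd c p)) w))) (at (snd c p))" .
  show "open (snd c ` (fst c \<inter> fst c'))"
    using assms by (intro open_overlap)
qed (use assms in auto)

text \<open>Transition maps are differentiable, so one chart suffices to test differentiability.\<close>

lemma diff_at_iff:
  assumes "c \<in> A" "p \<in> fst c"
  shows "diff_at A p h \<longleftrightarrow> (\<lambda>x. h (chart_inv c x)) differentiable (at (snd c p))"
  using assms has_derivative_change_chart[OF _ assms(1) _ assms(2)]
  unfolding diff_at_def differentiable_def by blast

lemma diff_at_has_derivative:
  assumes "diff_at A p h" "c \<in> A" "p \<in> fst c"
  shows "((\<lambda>x. h (chart_inv c x)) has_derivative (\<lambda>w. chart_tvec A c p w h)) (at (snd c p))"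
  using assms frechet_derivative_works unfolding chart_tvec_def diff_at_def by auto

lemma has_derivative_chart_tvec:
  assumes "c \<in> A" "p \<in> fst c" "((\<lambda>x. h (chart_inv c x)) has_derivative h') (at (snd c p))"
  shows "chart_tvec A c p w h = h' w"
proof -
  have "diff_at A p h"
    using assms diff_at_iff[OF assms(1,2)] unfolding differentiable_def by blast
  from diff_at_has_derivative[OF this assms(1,2)] assms(3) show ?thesis
    using has_derivative_unique by metis
qed

lemma Ck_fun_imp_diff_at: "Ck_fun A (Suc k) h \<Longrightarrow> diff_at A p h"
  by (auto simp: Ck_fun_def diff_at_def)

lemma chart_tvec_coordinate:
  assumes "c \<in> A" "p \<in> fst c"
  shows "chart_tvec A c p w (\<lambda>q. snd c q $ i) = w $ i"
proof (rule has_derivative_chart_tvec[OF assms])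
  show "((\<lambda>x. snd c (chart_inv c x) $ i) has_derivative (\<lambda>w. w $ i)) (at (snd c p))"
    by (rule has_derivative_transform_within_open[OF
          bounded_linear_imp_has_derivative[OF bounded_linear_vec_nth] open_range[OF assms(1)]])
      (use assms in \<open>auto simp: chart_inv_right\<close>)
qed

lemma chart_tvec_eq_iff:
  assumes "c \<in> A" "p \<in> fst c"
  shows "chart_tvec A c p v = chart_tvec A c p w \<longleftrightarrow> v = w"
  using chart_tvec_coordinate[OF assms] by (metis vec_eq_iff)

lemma linear_chart_tvec:
  assumes "c \<in> A" "p \<in> fst c"
  shows "linear (\<lambda>w. chart_tvec A c p w h)"
proof (cases "diff_at A p h")
  case True
  then show ?thesis
    using diff_at_has_derivative[OF True assms] has_derivative_linear by blast
next
  case False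
  then show ?thesis
    by (simp add: chart_tvec_def linear_iff)
qed

lemma chart_tvec_lincomb:
  assumes "c \<in> A" "p \<in> fst c"
  shows "chart_tvec A c p (a *\<^sub>R v + b *\<^sub>R w) =
    (\<lambda>h. a * chart_tvec A c p v h + b * chart_tvec A c p w h)"
proof
  fix h
  interpret linear "\<lambda>w. chart_tvec A c p w h"
    by (rule linear_chart_tvec[OF assms])
  show "chart_tvec A c p (a *\<^sub>R v + b *\<^sub>R w) h =
      a * chart_tvec A c p v h + b * chart_tvec A c p w h"
    by (simp add: add scale)
qed

lemma chart_tvec_0: "c \<in> A \<Longrightarrow> p \<in> fst c \<Longrightarrow> chart_tvec A c p 0 = (\<lambda>h. 0)"
  using chart_tvec_lincomb[of c p 0 0 0 0] by simp

lemma chart_tvec_change_chart: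
  assumes "c \<in> A" "c' \<in> A" "p \<in> fst c" "p \<in> fst c'"
  shows "chart_tvec A c p w =
    chart_tvec A c' p (frechet_derivative (\<lambda>x. snd c' (chart_inv c x)) (at (snd c p)) w)"
proof
  fix h
  show "chart_tvec A c p w h =
    chart_tvec A c' p (frechet_derivative (\<lambda>x. snd c' (chart_inv c x)) (at (snd c p)) w) h"
  proof (cases "diff_at A p h")
    case True
    then show ?thesis
      using has_derivative_chart_tvec[OF assms(1,3)] has_derivative_change_chart[OF assms]
        diff_at_has_derivative[OF True assms(2,4)] by blast
  qed (simp add: chart_tvec_def)
qed

lemma tangent_space_eq_chart:
  assumes "c \<in> A" "p \<in> fst c"
  shows "tangent_space A p = range (chart_tvec A c p)"
  using assms chart_tvec_change_chart[OF _ assms(1) _ assms(2)]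
  unfolding tangent_space_def by blast

lemma chart_tvec_in_tangent_space [simp]:
  "c \<in> A \<Longrightarrow> p \<in> fst c \<Longrightarrow> chart_tvec A c p w \<in> tangent_space A p"
  by (simp add: tangent_space_eq_chart)

lemma tangent_space_lincomb:
  assumes "v \<in> tangent_space A p" "w \<in> tangent_space A p"
  shows "(\<lambda>h. a * v h + b * w h) \<in> tangent_space A p"
proof -
  obtain c where c: "c \<in> A" "p \<in> fst c"
    by (rule ex_chart_around)
  then show ?thesis
    using assms chart_tvec_lincomb[OF c] by (auto simp: tangent_space_eq_chart[OF c] image_iff) metis
qed

lemma tangent_space_scale:
  "v \<in> tangent_space A p \<Longrightarrow> (\<lambda>h. a * v h) \<in> tangent_space A p"
  using tangent_space_lincomb[of v p v a 0] by simp

lemma tangent_space_0: "(\<lambda>h. 0) \<in> tangent_space A p"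
proof -
  obtain c where c: "c \<in> A" "p \<in> fst c"
    by (rule ex_chart_around)
  from chart_tvec_in_tangent_space[OF c, of 0] show ?thesis
    by (simp only: chart_tvec_0[OF c])
qed

text \<open>
  Evaluating a tangent vector at the coordinate functions recovers its components, which is what makes
  the components used for regularity of fields and for traces the ones in the coordinate basis.
\<close>

lemma tangent_vector_eq_chart_tvec:
  assumes "c \<in> A" "p \<in> fst c" "v \<in> tangent_space A p"
  shows "v = chart_tvec A c p (\<chi> i. v (\<lambda>q. snd c q $ i))"
proof -
  obtain w where "v = chart_tvec A c p w"
    using assms(3) tangent_space_eq_chart[OF assms(1,2)] by auto
  then show ?thesis
    using chart_tvec_coordinate[OF assms(1,2)] by simp
qed

lemma tangent_vector_expansion:
  assumes "c \<in> A" "p \<in> fst c" "v \<in> tangent_space A p"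
  shows "v h = (\<Sum>i\<in>UNIV. v (\<lambda>q. snd c q $ i) * coord_vec A c p i h)"
  using linear_vec_expansion[OF linear_chart_tvec[OF assms(1,2)]]
    tangent_vector_eq_chart_tvec[OF assms] by (metis (no_types, lifting) sum.cong vec_lambda_beta)

lemma tangent_vector_square:
  assumes "v \<in> tangent_space A p" "diff_at A p h"
  shows "v (\<lambda>q. h q * h q) = 2 * h p * v h"
proof -
  obtain c where c: "c \<in> A" "p \<in> fst c"
    by (rule ex_chart_around)
  then obtain w where v: "v = chart_tvec A c p w"
    using assms(1) tangent_space_eq_chart by auto
  have "((\<lambda>x. h (chart_inv c x) * h (chart_inv c x)) has_derivative
      (\<lambda>w. h p * chart_tvec A c p w h + chart_tvec A c p w h * h p)) (at (snd c p))"
    using has_derivative_mult[OF diff_at_has_derivative[OF assms(2) c]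
        diff_at_has_derivative[OF assms(2) c]] c by simp
  from has_derivative_chart_tvec[OF c this] show ?thesis
    by (simp add: v)
qed

section \<open>Functions and vector fields of class \<open>C\<^sup>k\<close>\<close>

lemma Ck_fun_mono: "Ck_fun A k h \<Longrightarrow> j \<le> k \<Longrightarrow> Ck_fun A j h"
  using Ck_on_mono unfolding Ck_fun_def by blast

lemma Ck_fun_mult: "Ck_fun A k h \<Longrightarrow> Ck_fun A k h' \<Longrightarrow> Ck_fun A k (\<lambda>p. h p * h' p)"
  unfolding Ck_fun_def by (intro ballI Ck_on_mult open_range) auto

lemma Ck_field_scale:
  assumes "Ck_fun A k h" "Ck_field A k X"
  shows "Ck_field A k (scale_field h X)"
  using assms unfolding Ck_fun_def Ck_field_def scale_field_def
  by (intro conjI allI ballI Ck_on_mult tangent_space_scale open_range) auto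

lemma smooth_fieldD: "smooth_field A X \<Longrightarrow> X p \<in> tangent_space A p"
  by (auto simp: smooth_field_def Ck_field_def)

lemma Ck_on_coord_vec:
  assumes "c \<in> A" "Ck_fun A (Suc k) f"
  shows "Ck_on k (snd c ` fst c) (\<lambda>x. coord_vec A c (chart_inv c x) i f)"
proof (rule Ck_on_cong)
  show "Ck_on k (snd c ` fst c)
      (\<lambda>x. frechet_derivative (\<lambda>x. f (chart_inv c x)) (at x) (axis i 1))"
    using assms by (auto simp: Ck_fun_def)
  show "open (snd c ` fst c)"
    using assms by (intro open_range)
  show "frechet_derivative (\<lambda>x. f (chart_inv c x)) (at x) (axis i 1) =
      coord_vec A c (chart_inv c x) i f" if "x \<in> snd c ` fst c" for x
    using that assms Ck_fun_imp_diff_at by (auto simp: chart_tvec_def chart_inv_right)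
qed

text \<open>
  The supply of test fields. In a chart the field is a bump function times a constant vector, and it is
  zero elsewhere. Its regularity in another chart is checked separately on the overlap of the charts,
  where it is the push-forward by a transition map, and off the compact support of the bump function,
  where it vanishes. The latter set is open since the support is closed, and the two sets cover since the
  support lies in the first chart.
\<close>

lemma ex_smooth_field:
  assumes "v \<in> tangent_space A p"
  obtains X where "smooth_field A X" "X p = v"
proof -
  obtain c where c: "c \<in> A" "p \<in> fst c"
    by (rule ex_chart_around)
  then obtain w where v: "v = chart_tvec A c p w"
    using assms tangent_space_eq_chart by auto
  obtain r where r: "r > 0" "cball (snd c p) r \<subseteq> snd c ` fst c"
    using open_range[OF c(1)] c(2) open_contains_cball by blast
  obtain \<psi> :: "real ^ 'n \<Rightarrow> real" where \<psi>: "\<And>k. Ck_on k UNIV \<psi>" "\<psi> (snd c p) = 1"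
    "\<And>x. x \<notin> cball (snd c p) r \<Longrightarrow> \<psi> x = 0"
    using ex_Ck_bump[OF r(1)] by blast
  define K where "K = chart_inv c ` cball (snd c p) r"
  have K: "closed K" "K \<subseteq> fst c"
  proof -
    have "continuous_on (cball (snd c p) r) (chart_inv c)"
      using chart_homeo[OF c(1)] r(2) continuous_on_subset by (auto simp: homeomorphism_def)
    then show "closed K"
      unfolding K_def by (intro compact_imp_closed compact_continuous_image compact_cball)
    show "K \<subseteq> fst c"
      using r(2) chart_inv_in[OF c(1)] by (auto simp: K_def)
  qed
  define X where "X = (\<lambda>q. if q \<in> fst c then chart_tvec A c q (\<psi> (snd c q) *\<^sub>R w) else (\<lambda>h. 0))"
  have X_outside: "X q = (\<lambda>h. 0)" if "q \<notin> K" for q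
  proof (cases "q \<in> fst c")
    case True
    then have "snd c q \<notin> cball (snd c p) r"
      using that c(1) by (auto simp: K_def intro: rev_image_eqI)
    then show ?thesis
      using True c(1) \<psi>(3) by (simp add: X_def chart_tvec_0)
  qed (simp add: X_def)
  have "Ck_on k (snd c' ` fst c') (\<lambda>x. X (chart_inv c' x) (\<lambda>q. snd c' q $ i))"
    if c': "c' \<in> A" for c' i k
  proof -
    let ?S = "snd c' ` (fst c' \<inter> fst c)" and ?T = "snd c' ` (fst c' - K)"
    let ?F = "\<lambda>x. X (chart_inv c' x) (\<lambda>q. snd c' q $ i)"
    let ?t = "\<lambda>x. snd c (chart_inv c' x)"
    let ?d = "\<lambda>y. frechet_derivative (\<lambda>y. snd c' (chart_inv c y)) (at y) w $ i"
    have openS: "open ?S"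
      using c c' by (intro open_overlap)
    have openT: "open ?T"
      using c' K by (intro open_chart_image open_Diff open_domain) auto
    have "Ck_on k ?S ?F"
    proof (rule Ck_on_cong[OF _ openS])
      have "Ck_on (Suc k) (snd c ` (fst c \<inter> fst c')) (\<lambda>y. snd c' (chart_inv c y))"
        using smooth_transition[OF c(1) c'] .
      then have d: "Ck_on k (snd c ` (fst c \<inter> fst c')) ?d"
        by (intro Ck_on_linear_compose[OF bounded_linear_vec_nth] open_overlap c c') auto
      show "Ck_on k ?S (\<lambda>x. \<psi> (?t x) * ?d (?t x))"
        by (intro Ck_on_mult openS Ck_on_compose[OF openS _ d] Ck_on_compose[OF openS _ \<psi>(1)]
            smooth_transition c c') (use c' in auto)
      fix x assume "x \<in> ?S"
      then obtain q where q: "q \<in> fst c'" "q \<in> fst c" "x = snd c' q"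
        by auto
      have "linear (frechet_derivative (\<lambda>y. snd c' (chart_inv c y)) (at (snd c q)))"
        using transition_has_derivative[OF c(1) c' q(2,1)] has_derivative_linear by blast
      then show "\<psi> (?t x) * ?d (?t x) = ?F x"
        using q c c' chart_tvec_change_chart[OF c(1) c' q(2,1)]
        by (simp add: X_def chart_tvec_coordinate linear_cmul)
    qed
    moreover have "Ck_on k ?T ?F"
      by (rule Ck_on_cong[OF Ck_on_const[of _ _ 0] openT]) (use c' in \<open>auto simp: X_outside\<close>)
    moreover have "snd c' ` fst c' = ?S \<union> ?T"
      using K(2) by auto
    ultimately show ?thesis
      using Ck_on_open_Un[OF openS openT] by simp
  qed
  moreover have "X q \<in> tangent_space A q" for q
    using c(1) by (simp add: X_def tangent_space_0)
  ultimately have "smooth_field A X"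
    by (auto simp: smooth_field_def Ck_field_def)
  moreover have "X p = v"
    using c \<psi>(2) by (simp add: X_def v)
  ultimately show thesis
    by (rule that)
qed

end

section \<open>Existence, uniqueness and regularity of gradients\<close>

context riemannian_manifold
begin

lemma metric_linear_right:
  assumes "u \<in> tangent_space A p" "v \<in> tangent_space A p" "w \<in> tangent_space A p"
  shows "g p w (\<lambda>h. a * u h + b * v h) = a * g p w u + b * g p w v"
  using metric_linear[OF assms, of a b] metric_sym[OF tangent_space_lincomb[OF assms(1,2)] assms(3)]
    metric_sym[OF assms(1,3)] metric_sym[OF assms(2,3)] by simp

text \<open>Test with \<open>u = v - w\<close> and use that the metric is positive definite.\<close>

lemma metric_nondegenerate:
  assumes "v \<in> tangent_space A p" "w \<in> tangent_space A p"
    and "\<And>u. u \<in> tangent_space A p \<Longrightarrow> g p u v = g p u w"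
  shows "v = w"
proof -
  define d where "d = (\<lambda>h. 1 * v h + (-1) * w h)"
  have d: "d \<in> tangent_space A p"
    unfolding d_def by (intro tangent_space_lincomb assms)
  have "g p d d = 0"
    using metric_linear_right[OF assms(1,2) d, of 1 "-1"] assms(3)[OF d] by (simp add: d_def)
  then have "d = (\<lambda>h. 0)"
    using metric_pos[OF d] by force
  then show ?thesis
    by (simp add: d_def fun_eq_iff)
qed

lemma field_eqI:
  assumes "\<And>p. G p \<in> tangent_space A p" "\<And>p. G' p \<in> tangent_space A p"
    and "\<And>X p. smooth_field A X \<Longrightarrow> g p (X p) (G p) = g p (X p) (G' p)"
  shows "G = G'"
proof
  fix p
  have "g p u (G p) = g p u (G' p)" if "u \<in> tangent_space A p" for u
    using ex_smooth_field[OF that] assms(3) by metis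
  then show "G p = G' p"
    by (rule metric_nondegenerate[OF assms(1,2)])
qed

definition gram :: "('m, 'n) chart \<Rightarrow> 'm \<Rightarrow> real ^ 'n ^ 'n" where
  "gram c p = (\<chi> i j. g p (coord_vec A c p i) (coord_vec A c p j))"

lemma linear_metric_chart:
  assumes "c \<in> A" "p \<in> fst c" "v \<in> tangent_space A p"
  shows "linear (\<lambda>w. g p (chart_tvec A c p w) v)" "linear (\<lambda>w. g p v (chart_tvec A c p w))"
proof -
  have comb: "g p (chart_tvec A c p (a *\<^sub>R x + b *\<^sub>R y)) v =
      a * g p (chart_tvec A c p x) v + b * g p (chart_tvec A c p y) v" for a b x y
    using metric_linear assms by (simp add: chart_tvec_lincomb)
  show "linear (\<lambda>w. g p (chart_tvec A c p w) v)"
    using comb[of 1 _ 1] comb[of _ _ 0 0] by (intro linearI) simp_all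
  then show "linear (\<lambda>w. g p v (chart_tvec A c p w))"
    using metric_sym assms by simp
qed

lemma metric_coord_vec:
  assumes "c \<in> A" "p \<in> fst c"
  shows "g p (coord_vec A c p i) (chart_tvec A c p w) = (gram c p *v w) $ i"
proof -
  have "g p (coord_vec A c p i) (chart_tvec A c p w) =
      (\<Sum>j\<in>UNIV. w $ j * g p (coord_vec A c p i) (coord_vec A c p j))"
    by (rule linear_vec_expansion[OF linear_metric_chart(2)[OF assms]]) (simp add: assms)
  also have "\<dots> = (gram c p *v w) $ i"
    by (simp add: gram_def matrix_vector_mult_def mult.commute)
  finally show ?thesis .
qed

text \<open>
  A vector in the kernel of the Gram matrix is orthogonal to the coordinate basis, hence to itself.
\<close>

lemma det_gram_nonzero:
  assumes "c \<in> A" "p \<in> fst c"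
  shows "det (gram c p) \<noteq> 0"
proof -
  have "w = 0" if "gram c p *v w = 0" for w
  proof -
    have "g p (coord_vec A c p i) (chart_tvec A c p w) = 0" for i
      using that by (simp add: metric_coord_vec[OF assms])
    moreover have "g p (chart_tvec A c p w) (chart_tvec A c p w) =
        (\<Sum>i\<in>UNIV. w $ i * g p (coord_vec A c p i) (chart_tvec A c p w))"
      by (rule linear_vec_expansion[OF linear_metric_chart(1)[OF assms]]) (simp add: assms)
    ultimately have "g p (chart_tvec A c p w) (chart_tvec A c p w) = 0"
      by simp
    then have "chart_tvec A c p w = (\<lambda>h. 0)"
      using metric_pos[OF chart_tvec_in_tangent_space[OF assms], of w] by force
    then show "w = 0"
      using chart_tvec_eq_iff[OF assms] chart_tvec_0[OF assms] by metis
  qed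
  then show ?thesis
    by (simp add: invertible_det_nz[symmetric] invertible_left_inverse matrix_left_invertible_ker)
qed

text \<open>The Riesz representation of the differential of \<open>f\<close> at a point.\<close>

lemma ex_riesz_vector:
  obtains v where "v \<in> tangent_space A p" "\<And>u. u \<in> tangent_space A p \<Longrightarrow> g p u v = u f"
proof -
  obtain c where c: "c \<in> A" "p \<in> fst c"
    by (rule ex_chart_around)
  obtain w where w: "gram c p *v w = (\<chi> i. coord_vec A c p i f)"
    using cramer[OF det_gram_nonzero[OF c]] by blast
  have "g p u (chart_tvec A c p w) = u f" if u: "u \<in> tangent_space A p" for u
  proof -
    obtain a where a: "u = chart_tvec A c p a"
      using u unfolding tangent_space_eq_chart[OF c] by blast
    have "g p u (chart_tvec A c p w) =
        (\<Sum>i\<in>UNIV. a $ i * g p (coord_vec A c p i) (chart_tvec A c p w))"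
      unfolding a by (rule linear_vec_expansion[OF linear_metric_chart(1)[OF c]]) (simp add: c)
    also have "\<dots> = (\<Sum>i\<in>UNIV. a $ i * coord_vec A c p i f)"
      by (simp add: metric_coord_vec[OF c] w)
    also have "\<dots> = u f"
      unfolding a by (rule linear_vec_expansion[OF linear_chart_tvec[OF c], symmetric])
    finally show ?thesis .
  qed
  with chart_tvec_in_tangent_space[OF c] show thesis
    by (rule that)
qed

text \<open>
  Cramer's rule writes the components of \<open>G\<close> in a chart as quotients of determinants, whose entries are
  the metric coefficients and the partial derivatives of \<open>f\<close>.
\<close>

lemma smooth_field_if_represents_differential:
  assumes "smooth_fun A f" "\<And>p. G p \<in> tangent_space A p"
    and G: "\<And>p u. u \<in> tangent_space A p \<Longrightarrow> g p u (G p) = u f"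
  shows "smooth_field A G"
proof -
  have "Ck_on k (snd c ` fst c) (\<lambda>x. G (chart_inv c x) (\<lambda>q. snd c q $ i))"
    if c: "c \<in> A" for c k i
  proof -
    let ?M = "\<lambda>x. \<chi> j l. if l = i then coord_vec A c (chart_inv c x) j f
      else gram c (chart_inv c x) $ j $ l"
    have f: "Ck_fun A (Suc k) f"
      using assms(1) by (simp add: smooth_fun_def)
    note op = open_range[OF c]
    have gram: "Ck_on k (snd c ` fst c) (\<lambda>x. gram c (chart_inv c x) $ j $ l)" for j l
      using metric_smooth[OF c] by (simp add: gram_def)
    have M: "Ck_on k (snd c ` fst c) (\<lambda>x. ?M x $ j $ l)" for j l
      using gram Ck_on_coord_vec[OF c f] by (cases "l = i") simp_all
    show ?thesis
    proof (rule Ck_on_cong[OF _ op])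
      show "Ck_on k (snd c ` fst c) (\<lambda>x. det (?M x) / det (gram c (chart_inv c x)))"
        using c det_gram_nonzero[OF c] by (intro Ck_on_divide Ck_on_det op M gram) auto
      fix x assume "x \<in> snd c ` fst c"
      then obtain p where p: "p \<in> fst c" "x = snd c p"
        by auto
      define w where "w = (\<chi> j. G p (\<lambda>q. snd c q $ j))"
      have "G p = chart_tvec A c p w"
        unfolding w_def by (rule tangent_vector_eq_chart_tvec[OF c p(1) assms(2)])
      then have "(gram c p *v w) $ j = coord_vec A c p j f" for j
        using metric_coord_vec[OF c p(1), of j w] G[OF chart_tvec_in_tangent_space[OF c p(1)]]
        by simp
      then have "gram c p *v w = (\<chi> j. coord_vec A c p j f)"
        by (simp add: vec_eq_iff)
      then have "w = (\<chi> l. det (\<chi> j m. if m = l then (\<chi> j. coord_vec A c p j f) $ j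
          else gram c p $ j $ m) / det (gram c p))"
        using cramer[OF det_gram_nonzero[OF c p(1)]] by blast
      then have "w $ i = det (?M x) / det (gram c p)"
        using c p by (simp cong: if_cong)
      then show "det (?M x) / det (gram c (chart_inv c x)) =
          G (chart_inv c x) (\<lambda>q. snd c q $ i)"
        using c p by (simp add: w_def)
    qed
  qed
  with assms(2) show ?thesis
    by (auto simp: smooth_field_def Ck_field_def)
qed

lemma
  assumes "smooth_fun A f"
  shows smooth_grad: "smooth_field A (grad A g f)"
    and metric_grad: "smooth_field A X \<Longrightarrow> g p (X p) (grad A g f p) = X p f"
proof -
  have "\<forall>p. \<exists>v. v \<in> tangent_space A p \<and> (\<forall>u\<in>tangent_space A p. g p u v = u f)"
    using ex_riesz_vector by metis
  then obtain G where G: "\<And>p. G p \<in> tangent_space A p"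
      "\<And>p u. u \<in> tangent_space A p \<Longrightarrow> g p u (G p) = u f"
    by metis
  have "smooth_field A (grad A g f) \<and>
      (\<forall>X. smooth_field A X \<longrightarrow> (\<forall>p. g p (X p) (grad A g f p) = X p f))"
    unfolding grad_def
  proof (rule theI[of _ G])
    show "smooth_field A G \<and> (\<forall>X. smooth_field A X \<longrightarrow> (\<forall>p. g p (X p) (G p) = X p f))"
      using smooth_field_if_represents_differential[OF assms G] G smooth_fieldD by blast
    show "H = G" if "smooth_field A H \<and>
        (\<forall>X. smooth_field A X \<longrightarrow> (\<forall>p. g p (X p) (H p) = X p f))" for H
      using that G smooth_fieldD by (intro field_eqI) auto
  qed
  then show "smooth_field A (grad A g f)"
    and "smooth_field A X \<Longrightarrow> g p (X p) (grad A g f p) = X p f"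
    by auto
qed

text \<open>
  The field \<open>e \<nabla>f\<close> is only \<open>C\<^sup>2\<close>, so it cannot itself serve as a test field; uniqueness rests on
  \<open>field_eqI\<close>, where the test fields are smooth and the compared fields arbitrary.
\<close>

lemma stoch_grad_eq:
  assumes "Ck_fun A 2 e" "smooth_fun A f"
  shows "stoch_grad A g e f = scale_field e (grad A g f)"
  unfolding stoch_grad_def
proof (rule the_equality)
  let ?G = "scale_field e (grad A g f)"
  have smooth: "smooth_field A (grad A g f)"
    by (rule smooth_grad[OF assms(2)])
  have "Ck_field A 2 ?G"
    using smooth by (intro Ck_field_scale assms) (simp add: smooth_field_def)
  moreover have inner: "g p (X p) (?G p) = scale_field e X p f" if X: "smooth_field A X" for X p
    using metric_linear_right[OF smooth_fieldD smooth_fieldD smooth_fieldD, OF smooth smooth X,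
        of p "e p" 0] metric_grad[OF assms(2) X] by (simp add: scale_field_def)
  ultimately show G: "Ck_field A 2 ?G \<and>
      (\<forall>X. smooth_field A X \<longrightarrow> (\<forall>p. g p (X p) (?G p) = scale_field e X p f))"
    by blast
  show "H = ?G" if "Ck_field A 2 H \<and>
      (\<forall>X. smooth_field A X \<longrightarrow> (\<forall>p. g p (X p) (H p) = scale_field e X p f))" for H
    using that G by (intro field_eqI) (auto simp: Ck_field_def)
qed

end

section \<open>The stochastic Laplace-Beltrami operator\<close>

context levi_civita_connection
begin

text \<open>
  In a coordinate basis the first term of the Leibniz rule \<open>\<partial>\<^sub>j(\<eta>) X + \<eta> D\<^sub>j X\<close> contributes
  \<open>\<Sum>\<^sub>j X\<^sup>j \<partial>\<^sub>j(\<eta>)\<close> to the trace, which is the expansion of \<open>X(\<eta>)\<close>.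
\<close>

lemma diverg_scale_field:
  assumes "Ck_fun A 1 \<eta>" "Ck_field A 1 X"
  shows "diverg A D (scale_field \<eta> X) p = \<eta> p * diverg A D X p + X p \<eta>"
proof -
  (* The chart in which the trace is defined. *)
  define c where "c = (SOME c. c \<in> A \<and> p \<in> fst c)"
  have c: "c \<in> A" "p \<in> fst c"
    using someI_ex[of "\<lambda>c. c \<in> A \<and> p \<in> fst c"] ex_chart_around[of p]
    unfolding c_def by blast+
  have X: "X p \<in> tangent_space A p"
    using assms(2) by (simp add: Ck_field_def)
  have "diverg A D (scale_field \<eta> X) p =
      (\<Sum>j\<in>UNIV. D p (coord_vec A c p j) (scale_field \<eta> X) (\<lambda>q. snd c q $ j))"
    by (simp add: diverg_def tangent_trace_def trace_def Let_def c_def)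
  also have "\<dots> = (\<Sum>j\<in>UNIV. X p (\<lambda>q. snd c q $ j) * coord_vec A c p j \<eta>) +
      \<eta> p * (\<Sum>j\<in>UNIV. D p (coord_vec A c p j) X (\<lambda>q. snd c q $ j))"
    using conn_Leibniz[OF _ assms] c by (simp add: sum.distrib sum_distrib_left mult.commute)
  also have "(\<Sum>j\<in>UNIV. X p (\<lambda>q. snd c q $ j) * coord_vec A c p j \<eta>) = X p \<eta>"
    by (rule tangent_vector_expansion[OF c X, symmetric])
  also have "(\<Sum>j\<in>UNIV. D p (coord_vec A c p j) X (\<lambda>q. snd c q $ j)) = diverg A D X p"
    by (simp add: diverg_def tangent_trace_def trace_def Let_def c_def)
  finally show ?thesis
    by simp
qed

lemma stoch_diverg_eq: "stoch_diverg A D e X = diverg A D (scale_field e X)"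
  by (simp add: stoch_diverg_def diverg_def)

lemma stoch_laplace_eq:
  assumes "Ck_fun A 2 e" "smooth_fun A f"
  shows "stoch_laplace A g D e f p =
    (e p)\<^sup>2 * laplace A g D f p + 2 * e p * grad A g f p e"
proof -
  let ?G = "grad A g f"
  have e: "Ck_fun A 1 e"
    using assms(1) by (rule Ck_fun_mono) simp
  have smooth: "smooth_field A ?G"
    by (rule smooth_grad[OF assms(2)])
  have "stoch_laplace A g D e f p = diverg A D (scale_field (\<lambda>p. e p * e p) ?G) p"
    by (simp add: stoch_laplace_def stoch_diverg_eq stoch_grad_eq[OF assms] scale_field_def
        mult.assoc)
  also have "\<dots> = e p * e p * laplace A g D f p + ?G p (\<lambda>p. e p * e p)"
    using smooth by (simp add: diverg_scale_field Ck_fun_mult e smooth_field_def laplace_def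
        del: One_nat_def)
  also have "?G p (\<lambda>p. e p * e p) = 2 * e p * ?G p e"
    using e by (intro tangent_vector_square smooth_fieldD smooth Ck_fun_imp_diff_at[of 0]) simp
  finally show ?thesis
    by (simp add: power2_eq_square)
qed

end

theorem lemma3:
  fixes A :: "('m::{t2_space, second_countable_topology}, 'n::finite) chart set"
    and g :: "'m \<Rightarrow> 'm tvec \<Rightarrow> 'm tvec \<Rightarrow> real"
    and D :: "'m \<Rightarrow> 'm tvec \<Rightarrow> 'm vfield \<Rightarrow> 'm tvec"
    and P :: "'w measure"
    and \<epsilon> :: "'w \<Rightarrow> 'm \<Rightarrow> real"
  assumes "riemannian_manifold A g"
    and "levi_civita_connection A g D"
    and "prob_space P"
    and "\<And>p. (\<lambda>\<omega>. \<epsilon> \<omega> p) \<in> borel_measurable P"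
    and "AE \<omega> in P. Ck_fun A 2 (\<epsilon> \<omega>)"
  shows "AE \<omega> in P. \<forall>f X. smooth_fun A f \<longrightarrow> smooth_field A X \<longrightarrow>
    stoch_grad A g (\<epsilon> \<omega>) f = scale_field (\<epsilon> \<omega>) (grad A g f) \<and>
    stoch_diverg A D (\<epsilon> \<omega>) X = diverg A D (scale_field (\<epsilon> \<omega>) X) \<and>
    (\<forall>p. stoch_laplace A g D (\<epsilon> \<omega>) f p =
       (\<epsilon> \<omega> p)\<^sup>2 * laplace A g D f p + 2 * \<epsilon> \<omega> p * grad A g f p (\<epsilon> \<omega>))"
proof -
  interpret levi_civita_connection A g D
    by (rule assms(2))
  from assms(5) show ?thesis
  proof eventually_elim
    case (elim \<omega>)
    then show ?case
      by (simp add: stoch_grad_eq stoch_diverg_eq stoch_laplace_eq)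
  qed
qed

end
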